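(* Let $N\ge 2$, let $B_1,\dots,B_{N+1}>0$, and let a tuple of $\frac{N(N+1)}{2}$ positive real numbers be given, all lying in $[s,\ell]$, where $(\ell,s)\in DW_{\mathbb{R}^N}$. Then the weighted Fermat-Frechet solution of this tuple consists of at most $$\frac{\left(\frac12 N(N+1)\right)!}{(N+1)!}$$ weighted Fermat trees (one for each of the mutually incongruent simplexes determined by the tuple). Moreover, for each such simplex $A_1A_2\cdots A_{N+1}$, with edge lengths $a_{ij}=|A_iA_j|$, its weighted Fermat tree belongs to one of the following two cases. (I) If for each index $k\in\{1,\dots,N+1\}$ $$\sum_{\substack{1\le i<j\le N+1\\ i,j\ne k}} B_iB_j\,\frac{a_{ik}^2+a_{jk}^2-a_{ij}^2}{2a_{ik}a_{jk}}>\frac{B_k^2-\sum_{i\neq k}B_i^2}{2},$$ then the tree is the weighted floating Fermat-Torricelli tree with branches $A_0A_1,\dots,A_0A_{N+1}$, where the weighted Fermat point $A_0$ is not a vertex. (II) If there is an index $k\in\{1,\dots,N+1\}$ such that $$\sum_{\substack{1\le i<j\le N+1\\ i,j\ne k}} B_iB_j\,\frac{a_{ik}^2+a_{jk}^2-a_{ij}^2}{2a_{ik}a_{jk}}\le\frac{B_k^2-\sum_{i\neq k}B_i^2}{2},$$ then the tree is the weighted absorbing Fermat-Torricelli tree with branches $A_kA_i$, $i\ne k$, i.e. the weighted Fermat point is $A_k$.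
   Context: Dekster-Wilker domain: $DW_{\mathbb{R}^N}=\{(\ell,s): \ell\ge 0,\ \lambda_N(\ell)\le s\le \ell\}$, where $\lambda_N(\ell)=\ell\sqrt{1-\frac{2(N+1)}{N(N+2)}}$ for even $N\ge2$ and $\lambda_N(\ell)=\ell\sqrt{1-\frac{2}{N+1}}$ for odd $N\ge3$. A simplex is determined by a tuple of $\frac{N(N+1)}{2}$ positive numbers if it is a nondegenerate $N$-simplex in $\mathbb{R}^N$ whose edge lengths are exactly the numbers of the tuple, arranged in some order. From each congruence class of simplexes determined by the tuple one representative with labelled vertices $A_1,\dots,A_{N+1}$ is taken; the weight $B_i$ is attached to $A_i$. The weighted Fermat point of a simplex is the unique point $X\in\mathbb{R}^N$ minimizing $\sum_{i} B_i|XA_i|$. The weighted Fermat tree is the union of the segments joining the weighted Fermat point to the vertices. It is called floating if the weighted Fermat point is not a vertex and absorbing if it is a vertex. The weighted Fermat-Frechet solution of the tuple is the set of the weighted Fermat trees of the mutually incongruent simplexes determined by the tuple. *)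

theory Defs
  imports "HOL-Analysis.Analysis" "HOL-Library.Multiset"
begin

definition DW_lambda :: "nat \<Rightarrow> real \<Rightarrow> real" where
  "DW_lambda N l =
     (if even N then l * sqrt (1 - 2 * (real N + 1) / (real N * (real N + 2)))
      else l * sqrt (1 - 2 / (real N + 1)))"

definition DW_domain :: "nat \<Rightarrow> (real \<times> real) set" where
  "DW_domain N = {(l, s). 0 \<le> l \<and> DW_lambda N l \<le> s \<and> s \<le> l}"

(* A labelled simplex is a function A whose values A 1, ..., A (N+1) are the vertices;
   its values at other indices play no role. The dimension of the ambient space is
   tied to N by the assumption CARD('n) = N where these notions are used. *)

definition edges :: "nat \<Rightarrow> (nat \<times> nat) set" where
  "edges N = {(i, j). 1 \<le> i \<and> i < j \<and> j \<le> N + 1}"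

definition simplex_of :: "nat \<Rightarrow> (nat \<Rightarrow> real ^ 'n) \<Rightarrow> (real ^ 'n) set" where
  "simplex_of N A = convex hull (A ` {1..N + 1})"

definition nondegenerate_simplex :: "nat \<Rightarrow> (nat \<Rightarrow> real ^ 'n) \<Rightarrow> bool" where
  "nondegenerate_simplex N A \<longleftrightarrow>
     inj_on A {1..N + 1} \<and> \<not> affine_dependent (A ` {1..N + 1})"

(* The list t is a tuple of candidate edge lengths; only its multiset of entries matters,
   which expresses that the entries are assigned to the edges in some order. *)
definition determined_by :: "nat \<Rightarrow> real list \<Rightarrow> (nat \<Rightarrow> real ^ 'n) \<Rightarrow> bool" where
  "determined_by N t A \<longleftrightarrow>
     nondegenerate_simplex N A \<and>
     image_mset (\<lambda>(i, j). dist (A i) (A j)) (mset_set (edges N)) = mset t"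

definition congruent_sets :: "(real ^ 'n) set \<Rightarrow> (real ^ 'n) set \<Rightarrow> bool" where
  "congruent_sets S T \<longleftrightarrow>
     (\<exists>f. (\<forall>x y. dist (f x) (f y) = dist x y) \<and> f ` S = T)"

(* R contains exactly one labelled representative of each congruence class of simplexes
   determined by t. Congruence is that of the simplexes as point sets, so it disregards
   the labelling of the vertices. *)
definition simplex_representatives ::
    "nat \<Rightarrow> real list \<Rightarrow> (nat \<Rightarrow> real ^ 'n) set \<Rightarrow> bool" where
  "simplex_representatives N t R \<longleftrightarrow>
     (\<forall>A\<in>R. determined_by N t A) \<and>
     (\<forall>A. determined_by N t A \<longrightarrow>
        (\<exists>!A'. A' \<in> R \<and> congruent_sets (simplex_of N A) (simplex_of N A')))"

definition weighted_distance_sum ::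
    "nat \<Rightarrow> (nat \<Rightarrow> real) \<Rightarrow> (nat \<Rightarrow> real ^ 'n) \<Rightarrow> real ^ 'n \<Rightarrow> real" where
  "weighted_distance_sum N B A X = (\<Sum>i=1..N + 1. B i * dist X (A i))"

definition minimizes_weighted_distance ::
    "nat \<Rightarrow> (nat \<Rightarrow> real) \<Rightarrow> (nat \<Rightarrow> real ^ 'n) \<Rightarrow> real ^ 'n \<Rightarrow> bool" where
  "minimizes_weighted_distance N B A X \<longleftrightarrow>
     (\<forall>Y. weighted_distance_sum N B A X \<le> weighted_distance_sum N B A Y)"

definition weighted_fermat_point ::
    "nat \<Rightarrow> (nat \<Rightarrow> real) \<Rightarrow> (nat \<Rightarrow> real ^ 'n) \<Rightarrow> real ^ 'n" where
  "weighted_fermat_point N B A = (THE X. minimizes_weighted_distance N B A X)"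

definition weighted_fermat_tree ::
    "nat \<Rightarrow> (nat \<Rightarrow> real) \<Rightarrow> (nat \<Rightarrow> real ^ 'n) \<Rightarrow> (real ^ 'n) set" where
  "weighted_fermat_tree N B A =
     (\<Union>i\<in>{1..N + 1}. closed_segment (weighted_fermat_point N B A) (A i))"

definition floating :: "nat \<Rightarrow> (nat \<Rightarrow> real) \<Rightarrow> (nat \<Rightarrow> real ^ 'n) \<Rightarrow> bool" where
  "floating N B A \<longleftrightarrow> weighted_fermat_point N B A \<notin> A ` {1..N + 1}"

definition absorbing :: "nat \<Rightarrow> (nat \<Rightarrow> real) \<Rightarrow> (nat \<Rightarrow> real ^ 'n) \<Rightarrow> bool" where
  "absorbing N B A \<longleftrightarrow> weighted_fermat_point N B A \<in> A ` {1..N + 1}"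

definition weighted_fermat_frechet_solution ::
    "nat \<Rightarrow> (nat \<Rightarrow> real) \<Rightarrow> (nat \<Rightarrow> real ^ 'n) set \<Rightarrow> (real ^ 'n) set set" where
  "weighted_fermat_frechet_solution N B R = weighted_fermat_tree N B ` R"

(* By the law of cosines the quotient is the cosine of the angle at A k
   between the edges to A i and A j. *)
definition weighted_cosine_sum ::
    "nat \<Rightarrow> (nat \<Rightarrow> real) \<Rightarrow> (nat \<Rightarrow> real ^ 'n) \<Rightarrow> nat \<Rightarrow> real" where
  "weighted_cosine_sum N B A k =
     (\<Sum>(i, j)\<in>{(i, j)\<in>edges N. i \<noteq> k \<and> j \<noteq> k}.
        B i * B j *
        (((dist (A i) (A k))\<^sup>2 + (dist (A j) (A k))\<^sup>2 - (dist (A i) (A j))\<^sup>2) /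
         (2 * dist (A i) (A k) * dist (A j) (A k))))"

end

theory Submission
  imports Defs
begin

text \<open>
  Projection onto the simplex decreases all distances to the vertices, so a minimizer exists and
  every minimizer lies in the simplex; it is unique because the vertices are not collinear, so the
  weighted distance sum would be strictly smaller at the midpoint of two minimizers. Expanding around the vertex
  \<open>A\<^sub>k\<close> shows that it is the minimizer iff the sum of the vectors \<open>B\<^sub>i u\<^sub>i\<close>, with \<open>u\<^sub>i\<close> the unit vector
  from \<open>A\<^sub>k\<close> to \<open>A\<^sub>i\<close>, has norm at most \<open>B\<^sub>k\<close>; the square of this norm is the sum of the \<open>B\<^sub>i\<^sup>2\<close> plus
  twice the weighted cosine sum.

  The convex hull of a Fermat tree is the simplex itself, so incongruent simplexes have different
  trees. For the bound, relabelling the vertices of a representative in all \<open>(N + 1)!\<close> ways gives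
  different assignments of the positions of the tuple to the edges (here \<open>N + 1 \<ge> 3\<close> is needed),
  and since the edge lengths determine a simplex up to isometry, incongruent simplexes never
  share an assignment.
\<close>

subsection \<open>Minimizers of weighted distance sums\<close>

lemma weighted_sum_minimizer_in_convex_hull:
  fixes A :: "'i \<Rightarrow> 'a::euclidean_space"
  assumes fin: "finite I" and ne: "I \<noteq> {}" and pos: "\<And>i. i \<in> I \<Longrightarrow> B i > 0"
    and min: "\<And>Y. (\<Sum>i\<in>I. B i * dist X (A i)) \<le> (\<Sum>i\<in>I. B i * dist Y (A i))"
  shows "X \<in> convex hull (A ` I)"
proof (rule ccontr)
  let ?C = "convex hull (A ` I)"
  let ?p = "closest_point ?C X"
  assume X: "X \<notin> ?C"
  have "closed ?C"
    using fin by (intro compact_imp_closed finite_imp_compact_convex_hull) simp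
  have "dist ?p (A i) < dist X (A i)" if i: "i \<in> I" for i
  proof -
    have pC: "?p \<in> ?C" using \<open>closed ?C\<close> ne by (intro closest_point_in_set) auto
    have Ai: "A i \<in> ?C" using i by (simp add: hull_inc)
    have "(X - ?p) \<bullet> (A i - ?p) \<le> 0"
      using closest_point_dot[OF convex_convex_hull \<open>closed ?C\<close> Ai] .
    moreover have "0 < (X - ?p) \<bullet> (X - ?p)" using pC X by auto
    ultimately have "(norm (A i - ?p))\<^sup>2 < (norm (A i - X))\<^sup>2"
      by (simp add: power2_norm_eq_inner inner_diff_left inner_diff_right inner_commute)
    then show ?thesis
      by (metis dist_norm norm_minus_commute norm_ge_zero power_less_imp_less_base)
  qed
  then have "(\<Sum>i\<in>I. B i * dist ?p (A i)) < (\<Sum>i\<in>I. B i * dist X (A i))"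
    using fin ne pos by (intro sum_strict_mono) auto
  with min[of ?p] show False by simp
qed

lemma weighted_sum_minimizer_exists:
  fixes A :: "'i \<Rightarrow> 'a::euclidean_space"
  assumes fin: "finite I" and ne: "I \<noteq> {}" and pos: "\<And>i. i \<in> I \<Longrightarrow> B i > 0"
  shows "\<exists>X. \<forall>Y. (\<Sum>i\<in>I. B i * dist X (A i)) \<le> (\<Sum>i\<in>I. B i * dist Y (A i))"
proof -
  let ?C = "convex hull (A ` I)"
  let ?f = "\<lambda>X. \<Sum>i\<in>I. B i * dist X (A i)"
  have "compact ?C"
    using fin by (intro finite_imp_compact_convex_hull) simp
  moreover have "continuous_on ?C ?f" by (intro continuous_intros)
  ultimately obtain X where X: "X \<in> ?C" "\<And>Y. Y \<in> ?C \<Longrightarrow> ?f X \<le> ?f Y"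
    using continuous_attains_inf[of ?C ?f] ne by auto
  have "?f X \<le> ?f Y" for Y
  proof -
    have C: "closed ?C" "?C \<noteq> {}" using \<open>compact ?C\<close> ne by (auto intro: compact_imp_closed)
    let ?p = "closest_point ?C Y"
    have "dist ?p (A i) \<le> dist Y (A i)" if i: "i \<in> I" for i
      using closest_point_lipschitz[OF convex_convex_hull C, of Y "A i"] i
      by (simp add: hull_inc closest_point_self)
    then have "?f ?p \<le> ?f Y"
      using pos by (intro sum_mono mult_left_mono) (auto intro: less_imp_le)
    moreover have "?f X \<le> ?f ?p" using X C by (simp add: closest_point_in_set)
    ultimately show ?thesis by linarith
  qed
  then show ?thesis by blast
qed

lemma dist_midpoint_eq:
  fixes X Y a :: "'a::real_normed_vector"
  shows "dist (midpoint X Y) a = norm ((X - a) + (Y - a)) / 2"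
proof -
  have "midpoint X Y - a = (1/2) *\<^sub>R ((X - a) + (Y - a))"
    unfolding midpoint_def by (simp add: algebra_simps flip: scaleR_add_left)
  then show ?thesis by (simp add: dist_norm)
qed

lemma dist_midpoint_le:
  fixes X Y a :: "'a::real_normed_vector"
  shows "dist (midpoint X Y) a \<le> (dist X a + dist Y a) / 2"
  unfolding dist_midpoint_eq using norm_triangle_ineq[of "X - a" "Y - a"] by (simp add: dist_norm)

lemma dist_midpoint_less:
  fixes X Y a :: "'a::euclidean_space"
  assumes "X \<noteq> Y" and a: "a \<notin> affine hull {X, Y}"
  shows "dist (midpoint X Y) a < (dist X a + dist Y a) / 2"
proof -
  have "norm ((X - a) + (Y - a)) \<noteq> norm (X - a) + norm (Y - a)"
  proof
    define p q where "p = norm (X - a)" and "q = norm (Y - a)"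
    assume "norm ((X - a) + (Y - a)) = norm (X - a) + norm (Y - a)"
    then have "p *\<^sub>R (Y - a) = q *\<^sub>R (X - a)"
      unfolding norm_triangle_eq p_def q_def by simp
    then have e: "(p - q) *\<^sub>R a = p *\<^sub>R Y - q *\<^sub>R X" by (simp add: algebra_simps)
    show False
    proof (cases "p = q")
      case True
      then have "p = 0" using e \<open>X \<noteq> Y\<close> by (simp add: algebra_simps)
      then show False using \<open>X \<noteq> Y\<close> True unfolding p_def q_def by simp
    next
      case False
      then have "a = (1 / (p - q)) *\<^sub>R ((p - q) *\<^sub>R a)" by simp
      also have "\<dots> = (- q / (p - q)) *\<^sub>R X + (p / (p - q)) *\<^sub>R Y"
        unfolding e by (simp add: algebra_simps)
      finally have "a = (- q / (p - q)) *\<^sub>R X + (p / (p - q)) *\<^sub>R Y" .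
      moreover have "- q / (p - q) + p / (p - q) = 1"
        using False by (simp flip: diff_divide_distrib)
      ultimately have "a \<in> affine hull {X, Y}" unfolding affine_hull_2 by blast
      with a show False by blast
    qed
  qed
  moreover have "norm ((X - a) + (Y - a)) \<le> norm (X - a) + norm (Y - a)"
    by (rule norm_triangle_ineq)
  ultimately show ?thesis unfolding dist_midpoint_eq by (simp add: dist_norm)
qed

lemma weighted_sum_minimizer_unique:
  fixes A :: "'i \<Rightarrow> 'a::euclidean_space"
  assumes fin: "finite I" and pos: "\<And>i. i \<in> I \<Longrightarrow> B i > 0"
    and ncol: "\<not> collinear (A ` I)"
    and minX: "\<And>Z. (\<Sum>i\<in>I. B i * dist X (A i)) \<le> (\<Sum>i\<in>I. B i * dist Z (A i))"
    and minY: "\<And>Z. (\<Sum>i\<in>I. B i * dist Y (A i)) \<le> (\<Sum>i\<in>I. B i * dist Z (A i))"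
  shows "X = Y"
proof (rule ccontr)
  assume "X \<noteq> Y"
  let ?M = "midpoint X Y"
  obtain k where k: "k \<in> I" "A k \<notin> affine hull {X, Y}"
    using ncol unfolding collinear_affine_hull by auto
  have "(\<Sum>i\<in>I. B i * dist ?M (A i)) < (\<Sum>i\<in>I. B i * ((dist X (A i) + dist Y (A i)) / 2))"
  proof (intro sum_strict_mono_ex1 fin ballI bexI[of _ k])
    show "B k * dist ?M (A k) < B k * ((dist X (A k) + dist Y (A k)) / 2)"
      using dist_midpoint_less[OF \<open>X \<noteq> Y\<close> k(2)] pos[OF k(1)] by simp
    fix i assume "i \<in> I"
    then show "B i * dist ?M (A i) \<le> B i * ((dist X (A i) + dist Y (A i)) / 2)"
      using pos by (intro mult_left_mono dist_midpoint_le) (auto intro: less_imp_le)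
  qed (use k in auto)
  also have "\<dots> = ((\<Sum>i\<in>I. B i * dist X (A i)) + (\<Sum>i\<in>I. B i * dist Y (A i))) / 2"
    by (simp add: sum.distrib[symmetric] sum_divide_distrib distrib_left)
  finally show False using minX[of ?M] minY[of ?M] minX[of Y] minY[of X] by argo
qed

lemma dist_ge_linear:
  fixes a c Y :: "'a::real_inner"
  shows "dist Y a \<ge> dist c a - sgn (a - c) \<bullet> (Y - c)"
proof -
  have "sgn (a - c) \<bullet> (a - Y) \<le> norm (sgn (a - c)) * norm (a - Y)"
    by (rule norm_cauchy_schwarz)
  also have "\<dots> \<le> norm (a - Y)" by (simp add: norm_sgn)
  finally have "sgn (a - c) \<bullet> (a - c) - sgn (a - c) \<bullet> (Y - c) \<le> norm (a - Y)"
    by (simp add: inner_diff_right)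
  moreover have "sgn (a - c) \<bullet> (a - c) = norm (a - c)"
    by (cases "a = c") (simp_all add: sgn_div_norm power2_norm_eq_inner[symmetric] power2_eq_square)
  ultimately show ?thesis by (simp add: dist_norm norm_minus_commute)
qed

lemma dist_le_quadratic:
  fixes a c v :: "'a::real_inner"
  assumes "a \<noteq> c"
  shows "dist (c + h *\<^sub>R v) a
    \<le> dist c a - h * (sgn (a - c) \<bullet> v) + h\<^sup>2 * ((norm v)\<^sup>2 / (2 * dist c a))"
proof -
  define w r x where "w = a - c" and "r = dist c a" and "x = dist (c + h *\<^sub>R v) a"
  have r: "r > 0" using assms by (simp add: r_def)
  have rw: "r = norm w" by (simp add: r_def w_def dist_norm norm_minus_commute)
  have "x = norm (w - h *\<^sub>R v)"
    by (simp add: x_def w_def dist_norm norm_minus_commute algebra_simps)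
  then have "x\<^sup>2 = (w - h *\<^sub>R v) \<bullet> (w - h *\<^sub>R v)"
    by (simp only: power2_norm_eq_inner)
  also have "\<dots> = r\<^sup>2 - 2 * h * (w \<bullet> v) + h\<^sup>2 * (norm v)\<^sup>2"
    unfolding rw power2_norm_eq_inner
    by (simp add: inner_diff_left inner_diff_right inner_commute power2_eq_square algebra_simps)
  finally have "x\<^sup>2 = r\<^sup>2 - 2 * h * (w \<bullet> v) + h\<^sup>2 * (norm v)\<^sup>2" .
  moreover have "2 * r * x \<le> r\<^sup>2 + x\<^sup>2" using sum_squares_bound[of r x] .
  ultimately have "x \<le> (2 * r\<^sup>2 - 2 * h * (w \<bullet> v) + h\<^sup>2 * (norm v)\<^sup>2) / (2 * r)"
    using r by (simp add: pos_le_divide_eq algebra_simps)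
  also have "\<dots> = r - h * (sgn w \<bullet> v) + h\<^sup>2 * ((norm v)\<^sup>2 / (2 * r))"
    using r by (simp add: sgn_div_norm rw[symmetric] field_simps power2_eq_square)
  finally show ?thesis by (simp add: w_def r_def x_def)
qed

lemma vertex_minimizer_iff:
  fixes A :: "'i \<Rightarrow> 'a::real_inner"
  assumes fin: "finite I" and k: "k \<in> I" and inj: "inj_on A I"
    and pos: "\<And>i. i \<in> I \<Longrightarrow> B i > 0"
  shows "(\<forall>Y. (\<Sum>i\<in>I. B i * dist (A k) (A i)) \<le> (\<Sum>i\<in>I. B i * dist Y (A i)))
    \<longleftrightarrow> norm (\<Sum>i\<in>I - {k}. B i *\<^sub>R sgn (A i - A k)) \<le> B k"
proof -
  let ?J = "I - {k}"
  define V where "V = (\<Sum>i\<in>?J. B i *\<^sub>R sgn (A i - A k))"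
  have split: "(\<Sum>i\<in>I. B i * dist Y (A i))
      = B k * dist Y (A k) + (\<Sum>i\<in>?J. B i * dist Y (A i))" for Y
    using fin k by (simp add: sum.remove)
  have Vdot: "(\<Sum>i\<in>?J. B i * (sgn (A i - A k) \<bullet> z)) = V \<bullet> z" for z
    unfolding V_def by (simp add: inner_sum_left)
  show ?thesis
    unfolding V_def[symmetric]
  proof (intro iffI allI)
    fix Y assume le: "norm V \<le> B k"
    have "(\<Sum>i\<in>?J. B i * dist Y (A i))
        \<ge> (\<Sum>i\<in>?J. B i * (dist (A k) (A i) - sgn (A i - A k) \<bullet> (Y - A k)))"
      using pos by (intro sum_mono mult_left_mono dist_ge_linear) (auto intro: less_imp_le)
    also have "(\<Sum>i\<in>?J. B i * (dist (A k) (A i) - sgn (A i - A k) \<bullet> (Y - A k)))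
        = (\<Sum>i\<in>?J. B i * dist (A k) (A i)) - V \<bullet> (Y - A k)"
      by (simp add: right_diff_distrib sum_subtractf Vdot)
    finally have 1: "(\<Sum>i\<in>?J. B i * dist (A k) (A i)) - V \<bullet> (Y - A k)
        \<le> (\<Sum>i\<in>?J. B i * dist Y (A i))" .
    have "V \<bullet> (Y - A k) \<le> norm V * norm (Y - A k)" by (rule norm_cauchy_schwarz)
    also have "\<dots> \<le> B k * dist Y (A k)"
      using le by (simp add: dist_norm mult_right_mono)
    finally show "(\<Sum>i\<in>I. B i * dist (A k) (A i)) \<le> (\<Sum>i\<in>I. B i * dist Y (A i))"
      using 1 unfolding split by simp
  next
    assume min: "\<forall>Y. (\<Sum>i\<in>I. B i * dist (A k) (A i)) \<le> (\<Sum>i\<in>I. B i * dist Y (A i))"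
    define C where "C = (\<Sum>i\<in>?J. B i * ((norm V)\<^sup>2 / (2 * dist (A k) (A i))))"
    have C: "C \<ge> 0" unfolding C_def using pos by (intro sum_nonneg) (simp add: less_imp_le)
    \<comment> \<open>Move from \<open>A k\<close> by \<open>h V\<close> and divide the resulting inequality by \<open>h\<close>.\<close>
    have step: "(norm V)\<^sup>2 - B k * norm V \<le> h * C" if h: "h > 0" for h
    proof -
      have "(\<Sum>i\<in>?J. B i * dist (A k + h *\<^sub>R V) (A i))
        \<le> (\<Sum>i\<in>?J. B i * (dist (A k) (A i) - h * (sgn (A i - A k) \<bullet> V)
              + h\<^sup>2 * ((norm V)\<^sup>2 / (2 * dist (A k) (A i)))))"
        using pos k inj_onD[OF inj]
        by (intro sum_mono mult_left_mono dist_le_quadratic) (auto intro: less_imp_le)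
      also have "\<dots> = (\<Sum>i\<in>?J. B i * dist (A k) (A i))
          - h * (\<Sum>i\<in>?J. B i * (sgn (A i - A k) \<bullet> V)) + h\<^sup>2 * C"
        unfolding C_def sum_distrib_left sum_subtractf[symmetric] sum.distrib[symmetric]
        by (intro sum.cong refl) (simp only: algebra_simps)
      finally have "h * (norm V)\<^sup>2 \<le> B k * (h * norm V) + h\<^sup>2 * C"
        using min[rule_format, of "A k + h *\<^sub>R V"] h
        unfolding split Vdot by (simp add: dist_norm power2_norm_eq_inner)
      then have "h * ((norm V)\<^sup>2 - B k * norm V) \<le> h * (h * C)"
        by (simp add: algebra_simps power2_eq_square)
      then show ?thesis using h by simp
    qed
    have "(norm V)\<^sup>2 - B k * norm V \<le> 0"
    proof (rule field_le_epsilon)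
      fix e :: real assume "e > 0"
      then have "(norm V)\<^sup>2 - B k * norm V \<le> e / (C + 1) * C"
        using C by (intro step) simp
      also have "\<dots> \<le> 0 + e" using C \<open>e > 0\<close> by (simp add: field_simps)
      finally show "(norm V)\<^sup>2 - B k * norm V \<le> 0 + e" .
    qed
    then have "norm V * norm V \<le> norm V * B k" by (simp add: power2_eq_square mult.commute)
    then show "norm V \<le> B k" using pos[OF k] by (cases "V = 0") auto
  qed
qed

lemma double_sum_symmetric:
  fixes g :: "'i::linorder \<Rightarrow> 'i \<Rightarrow> 'b::comm_semiring_1"
  assumes fin: "finite J" and sym: "\<And>i j. g i j = g j i"
  shows "(\<Sum>i\<in>J. \<Sum>j\<in>J. g i j)
    = (\<Sum>i\<in>J. g i i) + 2 * (\<Sum>(i, j)\<in>{(i, j). i \<in> J \<and> j \<in> J \<and> i < j}. g i j)"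
proof -
  let ?D = "(\<lambda>i. (i, i)) ` J" and ?L = "{(i, j). i \<in> J \<and> j \<in> J \<and> i < j}"
  let ?U = "prod.swap ` ?L"
  have L: "finite ?L" by (rule finite_subset[of _ "J \<times> J"]) (use fin in auto)
  have "(\<Sum>i\<in>J. \<Sum>j\<in>J. g i j) = (\<Sum>(i, j)\<in>J \<times> J. g i j)"
    by (simp add: sum.cartesian_product)
  also have "J \<times> J = ?D \<union> (?L \<union> ?U)" by force
  also have "(\<Sum>(i, j)\<in>?D \<union> (?L \<union> ?U). g i j)
      = (\<Sum>(i, j)\<in>?D. g i j) + ((\<Sum>(i, j)\<in>?L. g i j) + (\<Sum>(i, j)\<in>?U. g i j))"
    using fin L by (subst sum.union_disjoint, simp, simp, force,
        subst sum.union_disjoint, simp, simp, force) simp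
  also have "(\<Sum>(i, j)\<in>?D. g i j) = (\<Sum>i\<in>J. g i i)"
    by (subst sum.reindex) (auto simp: inj_on_def)
  also have "(\<Sum>(i, j)\<in>?U. g i j) = (\<Sum>(i, j)\<in>?L. g i j)"
    by (subst sum.reindex) (auto simp: inj_on_def sym intro!: sum.cong)
  finally show ?thesis by (simp add: mult_2)
qed

lemma inner_sgn_law_of_cosines:
  fixes a b c :: "'a::real_inner"
  shows "sgn (a - c) \<bullet> sgn (b - c)
    = ((dist a c)\<^sup>2 + (dist b c)\<^sup>2 - (dist a b)\<^sup>2) / (2 * dist a c * dist b c)"
proof -
  have "(dist a c)\<^sup>2 + (dist b c)\<^sup>2 - (dist a b)\<^sup>2 = 2 * ((a - c) \<bullet> (b - c))"
    by (simp add: dist_norm power2_norm_eq_inner inner_diff_left inner_diff_right inner_commute)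
  moreover have "sgn (a - c) \<bullet> sgn (b - c) = ((a - c) \<bullet> (b - c)) / (norm (a - c) * norm (b - c))"
    by (simp only: sgn_div_norm inner_scaleR_left inner_scaleR_right divide_inverse
        inverse_mult_distrib mult.assoc mult.commute mult.left_commute)
  ultimately show ?thesis by (simp add: dist_norm)
qed

lemma norm_weighted_directions:
  fixes A :: "nat \<Rightarrow> real ^ 'n"
  assumes inj: "inj_on A {1..N + 1}" and k: "k \<in> {1..N + 1}"
  shows "(norm (\<Sum>i\<in>{1..N + 1} - {k}. B i *\<^sub>R sgn (A i - A k)))\<^sup>2
    = (\<Sum>i\<in>{1..N + 1} - {k}. (B i)\<^sup>2) + 2 * weighted_cosine_sum N B A k"
proof -
  let ?J = "{1..N + 1} - {k}"
  let ?g = "\<lambda>i j. B i * B j * (sgn (A i - A k) \<bullet> sgn (A j - A k))"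
  have "(norm (\<Sum>i\<in>?J. B i *\<^sub>R sgn (A i - A k)))\<^sup>2 = (\<Sum>i\<in>?J. \<Sum>j\<in>?J. ?g i j)"
    unfolding power2_norm_eq_inner inner_sum_left inner_sum_right
    by (intro sum.cong refl) (simp add: inner_commute)
  also have "\<dots> = (\<Sum>i\<in>?J. ?g i i) + 2 * (\<Sum>(i, j)\<in>{(i, j). i \<in> ?J \<and> j \<in> ?J \<and> i < j}. ?g i j)"
    by (intro double_sum_symmetric) (auto simp: inner_commute)
  also have "{(i, j). i \<in> ?J \<and> j \<in> ?J \<and> i < j} = {(i, j) \<in> edges N. i \<noteq> k \<and> j \<noteq> k}"
    by (auto simp: edges_def)
  also have "(\<Sum>(i, j)\<in>{(i, j) \<in> edges N. i \<noteq> k \<and> j \<noteq> k}. ?g i j) = weighted_cosine_sum N B A k"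
    unfolding weighted_cosine_sum_def inner_sgn_law_of_cosines ..
  also have "(\<Sum>i\<in>?J. ?g i i) = (\<Sum>i\<in>?J. (B i)\<^sup>2)"
  proof (intro sum.cong refl)
    fix i assume "i \<in> ?J"
    then have "A i - A k \<noteq> 0" using inj_onD[OF inj, of i k] k by auto
    then have "sgn (A i - A k) \<bullet> sgn (A i - A k) = 1"
      by (simp add: power2_norm_eq_inner[symmetric] norm_sgn)
    then show "?g i i = (B i)\<^sup>2" by (simp add: power2_eq_square)
  qed
  finally show ?thesis .
qed

subsection \<open>Affine frames with equal distances\<close>

lemma isometry_of_affine_frames:
  fixes A A' :: "'i \<Rightarrow> 'a::euclidean_space"
  assumes inj: "inj_on A I" and indep: "\<not> affine_dependent (A ` I)"
    and card: "card I = DIM('a) + 1"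
    and dist: "\<And>i j. i \<in> I \<Longrightarrow> j \<in> I \<Longrightarrow> dist (A' i) (A' j) = dist (A i) (A j)"
  shows "\<exists>f. (\<forall>x y. dist (f x) (f y) = dist x y) \<and> f ` (convex hull (A ` I)) = convex hull (A' ` I)"
proof -
  have "I \<noteq> {}" using card by auto
  then obtain o' where o': "o' \<in> I" by blast
  define a b where "a = A o'" and "b = A' o'"
  let ?V = "(\<lambda>x. - a + x) ` (A ` I - {a})"
  have ind: "independent ?V"
    using indep affine_dependent_iff_dependent2[of a "A ` I"] o' unfolding a_def by auto
  have finI: "finite I" using card by (auto intro: card_ge_0_finite)
  have "card (A ` I) = DIM('a) + 1" using card inj by (simp add: card_image)
  then have "card ?V = DIM('a)"
    using o' finI unfolding a_def by (subst card_image) (auto simp: card_Diff_singleton)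
  then have span: "UNIV \<subseteq> span ?V"
    using ind by (intro card_ge_dim_independent) auto
  obtain g where g: "linear g"
    "\<And>x. x \<in> ?V \<Longrightarrow> g x = A' (inv_into I A (a + x)) - b"
    using linear_independent_extend[OF ind, of "\<lambda>x. A' (inv_into I A (a + x)) - b"] by metis
  have gA: "g (A i - a) = A' i - b" if i: "i \<in> I" for i
  proof (cases "A i = a")
    case True
    then have "i = o'" using inj_onD[OF inj] i o' by (simp add: a_def)
    then show ?thesis using linear_0[OF g(1)] by (simp add: a_def b_def)
  next
    case False
    then have "A i - a \<in> ?V" using i by (auto intro!: image_eqI[of _ _ "A i"])
    then show ?thesis using g(2)[of "A i - a"] i inv_into_f_f[OF inj i] by simp
  qed
  have polar: "2 * ((x - z) \<bullet> (y - z)) = (dist x z)\<^sup>2 + (dist y z)\<^sup>2 - (dist x y)\<^sup>2"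
    for x y z :: 'a
    by (simp add: dist_norm power2_norm_eq_inner inner_diff_left inner_diff_right inner_commute)
  have "g x \<bullet> g y = x \<bullet> y" for x y
  proof (rule bilinear_eq[where f = "\<lambda>x y. g x \<bullet> g y" and g = "\<lambda>x y. x \<bullet> y"
        and S = UNIV and T = UNIV and B = ?V and C = ?V])
    show "bilinear (\<lambda>x y. g x \<bullet> g y)"
      using g(1) unfolding bilinear_def
      by (auto intro!: linearI simp: linear_add linear_scale inner_add_left inner_add_right)
    show "bilinear (\<lambda>x y :: 'a. x \<bullet> y)"
      unfolding bilinear_def
      by (auto intro!: linearI simp: inner_add_left inner_add_right)
    fix x y assume "x \<in> ?V" "y \<in> ?V"
    then obtain i j where i: "i \<in> I" "x = A i - a" and j: "j \<in> I" "y = A j - a" by auto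
    have "2 * ((A' i - b) \<bullet> (A' j - b)) = 2 * ((A i - a) \<bullet> (A j - a))"
      unfolding polar using i j o' by (simp add: a_def b_def dist)
    then show "g x \<bullet> g y = x \<bullet> y" using i j by (simp add: gA)
  qed (use span in auto)
  then have norm: "norm (g x) = norm x" for x by (simp add: norm_eq_sqrt_inner)
  define f where "f = (\<lambda>x. b + x) \<circ> g \<circ> (\<lambda>x. - a + x)"
  have "dist (f x) (f y) = dist x y" for x y
    using norm[of "x - y"] linear_diff[OF g(1), of "- a + x" "- a + y"]
    by (simp add: f_def dist_norm)
  moreover have "f ` (convex hull (A ` I)) = convex hull (f ` (A ` I))"
    unfolding f_def image_comp[symmetric]
    by (simp only: convex_hull_translation convex_hull_linear_image[OF g(1), symmetric])
  moreover have "f ` (A ` I) = A' ` I"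
    unfolding image_image by (intro image_cong refl) (simp add: f_def gA)
  ultimately show ?thesis by metis
qed

lemma mset_arrangement:
  assumes fin: "finite E" and eq: "image_mset d (mset_set E) = mset t"
  shows "\<exists>\<sigma>. bij_betw \<sigma> E {..<length t} \<and> (\<forall>e\<in>E. t ! \<sigma> e = d e)"
proof -
  obtain es where es: "set es = E" "distinct es"
    using finite_distinct_list[OF fin] by blast
  have "mset_set E = mset es" using mset_set_set[OF es(2)] unfolding es(1) .
  then have "mset (map d es) = mset t" using eq by (simp only: mset_map)
  then obtain p where p: "p permutes {..<length t}" "permute_list p t = map d es"
    by (rule mset_eq_permutation)
  have len: "length es = length t" using arg_cong[OF p(2), of length] by simp
  let ?n = "inv_into {..<length t} ((!) es)"
  have nth: "bij_betw ((!) es) {..<length t} E"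
    by (rule bij_betw_nth[OF es(2)]) (simp_all add: es(1) len)
  have "bij_betw (p \<circ> ?n) E {..<length t}"
    using bij_betw_trans[OF bij_betw_inv_into[OF nth] permutes_imp_bij[OF p(1)]] .
  moreover have "t ! (p \<circ> ?n) e = d e" if e: "e \<in> E" for e
  proof -
    have n: "?n e < length t" "es ! ?n e = e"
      using bij_betw_apply[OF bij_betw_inv_into[OF nth] e] bij_betw_inv_into_right[OF nth e]
      by simp_all
    have "t ! p (?n e) = permute_list p t ! ?n e"
      by (rule permute_list_nth[OF p(1) n(1), symmetric])
    also have "\<dots> = d e" unfolding p(2) using n len by simp
    finally show ?thesis by simp
  qed
  ultimately show ?thesis by blast
qed

subsection \<open>Counting congruence classes\<close>

lemma congruent_sets_refl: "congruent_sets S S"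
  unfolding congruent_sets_def by (intro exI[of _ "\<lambda>x. x"]) simp

lemma representatives_unique:
  assumes reps: "simplex_representatives N t R" and A: "A \<in> R" and A': "A' \<in> R"
    and cong: "congruent_sets (simplex_of N A) (simplex_of N A')"
  shows "A = A'"
proof -
  have "determined_by N t A" using reps A unfolding simplex_representatives_def by blast
  then have "\<exists>!A''. A'' \<in> R \<and> congruent_sets (simplex_of N A) (simplex_of N A'')"
    using reps unfolding simplex_representatives_def by blast
  with A A' cong congruent_sets_refl show ?thesis by blast
qed

lemma congruent_of_equal_distances:
  fixes A A' :: "nat \<Rightarrow> real ^ 'n"
  assumes dim: "CARD('n) = N" and nd: "nondegenerate_simplex N A"
    and p: "p permutes {1..N + 1}" and p': "p' permutes {1..N + 1}"
    and dist: "\<And>i j. i \<in> {1..N + 1} \<Longrightarrow> j \<in> {1..N + 1} \<Longrightarrow> i \<noteq> j \<Longrightarrow>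
      dist (A (p i)) (A (p j)) = dist (A' (p' i)) (A' (p' j))"
  shows "congruent_sets (simplex_of N A) (simplex_of N A')"
proof -
  let ?I = "{1..N + 1}"
  have im: "(A \<circ> p) ` ?I = A ` ?I" "(A' \<circ> p') ` ?I = A' ` ?I"
    unfolding image_comp[symmetric] permutes_image[OF p] permutes_image[OF p'] by simp_all
  have "inj_on (A \<circ> p) ?I"
    using nd permutes_image[OF p] permutes_inj_on[OF p]
    by (intro comp_inj_on) (simp_all add: nondegenerate_simplex_def)
  moreover have "\<not> affine_dependent ((A \<circ> p) ` ?I)"
    using nd unfolding im nondegenerate_simplex_def by blast
  moreover have "card ?I = DIM(real ^ 'n) + 1" using dim by simp
  moreover have "dist ((A' \<circ> p') i) ((A' \<circ> p') j) = dist ((A \<circ> p) i) ((A \<circ> p) j)"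
    if "i \<in> ?I" "j \<in> ?I" for i j
    using dist[OF that] by (cases "i = j") auto
  ultimately have "\<exists>f. (\<forall>x y. dist (f x) (f y) = dist x y) \<and>
      f ` (convex hull ((A \<circ> p) ` ?I)) = convex hull ((A' \<circ> p') ` ?I)"
    by (rule isometry_of_affine_frames)
  then show ?thesis unfolding im congruent_sets_def simplex_of_def .
qed

lemma permutation_determined_by_pairs:
  fixes N :: nat
  assumes N: "N \<ge> 2" and p: "p permutes {1..N + 1}" and p': "p' permutes {1..N + 1}"
    and eq: "\<And>i j. i \<in> {1..N + 1} \<Longrightarrow> j \<in> {1..N + 1} \<Longrightarrow> i \<noteq> j \<Longrightarrow> {p i, p j} = {p' i, p' j}"
  shows "p = p'"
proof
  fix x
  show "p x = p' x"
  proof (cases "x \<in> {1..N + 1}")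
    case True
    obtain y z where yz: "y \<in> {1..N + 1}" "z \<in> {1..N + 1}" "y \<noteq> x" "z \<noteq> x" "y \<noteq> z"
    proof (cases "x = 1")
      case True
      then show ?thesis using that[of 2 3] N by simp
    next
      case False
      then show ?thesis
        using that[of 1 "if x = 2 then 3 else 2"] N by (simp split: if_splits)
    qed
    have "p' y \<noteq> p' z" using permutes_inj[OF p'] yz by (auto dest: injD)
    then show ?thesis
      using eq[OF True yz(1)] eq[OF True yz(2)] yz by (auto simp: doubleton_eq_iff)
  next
    case False
    then show ?thesis using p p' by (simp add: permutes_not_in)
  qed
qed

lemma card_representatives:
  fixes R :: "(nat \<Rightarrow> real ^ 'n) set"
  assumes dim: "CARD('n) = N" and N: "N \<ge> 2" and reps: "simplex_representatives N t R"
  shows "finite R" and "card R * fact (N + 1) \<le> (fact (length t) :: nat)"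
proof -
  let ?I = "{1..N + 1}"
  let ?P = "{p. p permutes ?I}"
  let ?T = "{..<length t}"
  let ?S = "{f \<in> edges N \<rightarrow>\<^sub>E ?T. inj_on f (edges N)}"
  have finE: "finite (edges N)"
    by (rule finite_subset[of _ "?I \<times> ?I"]) (auto simp: edges_def)
  have det: "determined_by N t A" if "A \<in> R" for A
    using reps that unfolding simplex_representatives_def by blast
  have "\<forall>A\<in>R. \<exists>\<sigma>. bij_betw \<sigma> (edges N) ?T \<and>
      (\<forall>e\<in>edges N. t ! \<sigma> e = (case e of (i, j) \<Rightarrow> dist (A i) (A j)))"
    using det finE by (intro ballI mset_arrangement) (auto simp: determined_by_def)
  then obtain \<sigma> where bij: "\<And>A. A \<in> R \<Longrightarrow> bij_betw (\<sigma> A) (edges N) ?T"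
    and val: "\<And>A e. A \<in> R \<Longrightarrow> e \<in> edges N \<Longrightarrow> t ! \<sigma> A e = (case e of (i, j) \<Rightarrow> dist (A i) (A j))"
    using bchoice[of R] by metis
  \<comment> \<open>\<open>edges N\<close> contains ordered pairs only, so relabelled edges must be sorted again.\<close>
  define G where "G A i j = \<sigma> A (min i j, max i j)" for A i j
  define F where "F = (\<lambda>(A, p). restrict (\<lambda>(i, j). G A (p i) (p j)) (edges N))"
  have edge: "(min i j, max i j) \<in> edges N" if "i \<in> ?I" "j \<in> ?I" "i \<noteq> j" for i j
    using that by (auto simp: edges_def min_def max_def)
  have Gdist: "t ! G A i j = dist (A i) (A j)" if "A \<in> R" "i \<in> ?I" "j \<in> ?I" "i \<noteq> j" for A i j
    using val[OF that(1) edge[OF that(2-4)]] unfolding G_def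
    by (auto simp: min_def max_def dist_commute)
  have Ginj: "{i, j} = {i', j'}"
    if "A \<in> R" "i \<in> ?I" "j \<in> ?I" "i \<noteq> j" "i' \<in> ?I" "j' \<in> ?I" "i' \<noteq> j'" "G A i j = G A i' j'"
    for A i j i' j'
  proof -
    have "(min i j, max i j) = (min i' j', max i' j')"
      using that(8) inj_onD[OF bij_betw_imp_inj_on[OF bij[OF that(1)]] _ edge[OF that(2-4)] edge[OF that(5-7)]]
      unfolding G_def by blast
    then show ?thesis by (auto simp: min_def max_def split: if_splits)
  qed
  have pI: "p i \<in> ?I" if "p \<in> ?P" "i \<in> ?I" for p i
    using that permutes_in_image[of p ?I i] by blast
  have pne: "p i \<noteq> p j" if "p \<in> ?P" "i \<noteq> j" for p i j
    using that permutes_inj[of p ?I] by (auto dest: injD)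
  have FS: "F ` (R \<times> ?P) \<subseteq> ?S"
  proof clarify
    fix A p assume A: "A \<in> R" and p: "p permutes ?I"
    then have P: "p \<in> ?P" by simp
    have "F (A, p) \<in> edges N \<rightarrow>\<^sub>E ?T"
    proof (rule PiE_I)
      fix e assume "e \<in> edges N"
      then obtain i j where e: "e = (i, j)" "i \<in> ?I" "j \<in> ?I" "i \<noteq> j" "(i, j) \<in> edges N"
        by (auto simp: edges_def)
      then have "(min (p i) (p j), max (p i) (p j)) \<in> edges N"
        using edge pI[OF P] pne[OF P] by blast
      then show "F (A, p) e \<in> ?T"
        using bij[OF A] e by (auto simp: F_def G_def bij_betw_def)
    qed (auto simp: F_def)
    moreover have "inj_on (F (A, p)) (edges N)"
    proof (rule inj_onI)
      fix e e' assume e: "e \<in> edges N" "e' \<in> edges N" and eq: "F (A, p) e = F (A, p) e'"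
      obtain i j i' j' where ij: "e = (i, j)" "e' = (i', j')" "i < j" "i' < j'"
        "i \<in> ?I" "j \<in> ?I" "i' \<in> ?I" "j' \<in> ?I"
        using e by (auto simp: edges_def)
      have "G A (p i) (p j) = G A (p i') (p j')" using eq e ij by (simp add: F_def)
      then have "p ` {i, j} = p ` {i', j'}"
        using Ginj[OF A pI[OF P] pI[OF P] pne[OF P] pI[OF P] pI[OF P] pne[OF P]] ij by simp
      then have "{i, j} = {i', j'}" by (rule inj_image_eq_iff[THEN iffD1, OF permutes_inj[OF p]])
      then show "e = e'" using ij by (auto simp: doubleton_eq_iff)
    qed
    ultimately show "F (A, p) \<in> edges N \<rightarrow>\<^sub>E ?T \<and> inj_on (F (A, p)) (edges N)" ..
  qed
  have Finj: "inj_on F (R \<times> ?P)"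
  proof (rule inj_onI, clarify)
    fix A p A' p'
    assume A: "A \<in> R" and A': "A' \<in> R" and p: "p permutes ?I" and p': "p' permutes ?I"
      and eq: "F (A, p) = F (A', p')"
    have P: "p \<in> ?P" "p' \<in> ?P" using p p' by auto
    have Gsym: "G A i j = G A j i" for A i j by (simp add: G_def min.commute max.commute)
    have less: "G A (p i) (p j) = G A' (p' i) (p' j)" if "i \<in> ?I" "j \<in> ?I" "i < j" for i j
      using fun_cong[OF eq, of "(i, j)"] that by (simp add: F_def edges_def)
    have G: "G A (p i) (p j) = G A' (p' i) (p' j)" if "i \<in> ?I" "j \<in> ?I" "i \<noteq> j" for i j
      using less[of i j] less[of j i] that Gsym by (metis linorder_neq_iff)
    have "dist (A (p i)) (A (p j)) = dist (A' (p' i)) (A' (p' j))"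
      if "i \<in> ?I" "j \<in> ?I" "i \<noteq> j" for i j
      using G[OF that] Gdist[OF A pI[OF P(1)] pI[OF P(1)] pne[OF P(1)]]
        Gdist[OF A' pI[OF P(2)] pI[OF P(2)] pne[OF P(2)]] that by metis
    then have "congruent_sets (simplex_of N A) (simplex_of N A')"
      using det[OF A] unfolding determined_by_def
      by (intro congruent_of_equal_distances[OF dim _ p p']) auto
    then have "A = A'" by (rule representatives_unique[OF reps A A'])
    moreover have "p = p'"
    proof (rule permutation_determined_by_pairs[OF N p p'])
      fix i j assume ij: "i \<in> ?I" "j \<in> ?I" "i \<noteq> j"
      show "{p i, p j} = {p' i, p' j}"
        using Ginj[OF A pI[OF P(1)] pI[OF P(1)] pne[OF P(1)] pI[OF P(2)] pI[OF P(2)] pne[OF P(2)]]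
          ij G[OF ij] \<open>A = A'\<close> by blast
    qed
    ultimately show "A = A' \<and> p = p'" ..
  qed
  have finS: "finite ?S"
    by (rule finite_subset[of _ "edges N \<rightarrow>\<^sub>E ?T"]) (auto intro: finite_PiE finE)
  have "finite (R \<times> ?P)"
    using finite_imageD[OF finite_subset[OF FS finS] Finj] .
  moreover have "id \<in> ?P" using permutes_id by blast
  ultimately show "finite R" using finite_cartesian_productD1 by blast
  show "card R * fact (N + 1) \<le> (fact (length t) :: nat)"
  proof (cases "R = {}")
    case False
    then obtain A where "A \<in> R" by blast
    then have cE: "card (edges N) = length t" using bij_betw_same_card[OF bij] by fastforce
    have "card R * fact (N + 1) = card (R \<times> ?P)"
      using card_permutations[of ?I "N + 1"] by (simp add: card_cartesian_product)
    also have "\<dots> \<le> card ?S" by (rule card_inj_on_le[OF Finj FS finS])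
    also have "\<dots> = fact (length t)"
      using card_inj_on_subset_funcset[OF finE finite_lessThan order_refl, of "length t"]
      by (simp add: cE fact_prod_rev)
    finally show ?thesis .
  qed simp
qed

subsection \<open>Fermat points and Fermat trees of simplexes\<close>

lemma nondegenerate_simplex_not_collinear:
  fixes A :: "nat \<Rightarrow> real ^ 'n"
  assumes N: "N \<ge> 2" and nd: "nondegenerate_simplex N A"
  shows "\<not> collinear (A ` {1..N + 1})"
proof -
  have "card (A ` {1..N + 1}) = N + 1"
    using nd by (simp add: nondegenerate_simplex_def card_image)
  then show ?thesis
    using N nd aff_dim_affine_independent[of "A ` {1..N + 1}"]
    by (simp add: nondegenerate_simplex_def collinear_aff_dim)
qed

lemma weighted_fermat_point_unique:
  fixes A :: "nat \<Rightarrow> real ^ 'n"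
  assumes N: "N \<ge> 2" and weights: "\<And>i. i \<in> {1..N + 1} \<Longrightarrow> B i > 0"
    and nd: "nondegenerate_simplex N A"
  shows "\<exists>!X. minimizes_weighted_distance N B A X"
proof (rule ex_ex1I)
  show "\<exists>X. minimizes_weighted_distance N B A X"
    unfolding minimizes_weighted_distance_def weighted_distance_sum_def
    by (rule weighted_sum_minimizer_exists) (use weights in auto)
  show "X = Y" if "minimizes_weighted_distance N B A X" "minimizes_weighted_distance N B A Y" for X Y
    by (rule weighted_sum_minimizer_unique[where I = "{1..N + 1}" and B = B and A = A])
      (use that weights nondegenerate_simplex_not_collinear[OF N nd] in
        \<open>auto simp: minimizes_weighted_distance_def weighted_distance_sum_def\<close>)
qed

lemma weighted_fermat_point_minimizes:
  assumes "\<exists>!X. minimizes_weighted_distance N B A X"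
  shows "minimizes_weighted_distance N B A (weighted_fermat_point N B A)"
  unfolding weighted_fermat_point_def by (rule theI'[OF assms])

lemma convex_hull_weighted_fermat_tree:
  fixes A :: "nat \<Rightarrow> real ^ 'n"
  assumes weights: "\<And>i. i \<in> {1..N + 1} \<Longrightarrow> B i > 0"
    and ex1: "\<exists>!X. minimizes_weighted_distance N B A X"
  shows "convex hull (weighted_fermat_tree N B A) = simplex_of N A"
proof
  let ?X = "weighted_fermat_point N B A"
  have X: "?X \<in> simplex_of N A"
    unfolding simplex_of_def
    by (rule weighted_sum_minimizer_in_convex_hull[where B = B])
      (use weights weighted_fermat_point_minimizes[OF ex1] in
        \<open>auto simp: minimizes_weighted_distance_def weighted_distance_sum_def\<close>)
  have "closed_segment ?X (A i) \<subseteq> simplex_of N A" if "i \<in> {1..N + 1}" for i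
    using X that unfolding simplex_of_def
    by (intro closed_segment_subset) (auto intro: hull_inc)
  then have "weighted_fermat_tree N B A \<subseteq> simplex_of N A"
    unfolding weighted_fermat_tree_def by (rule UN_least)
  then show "convex hull (weighted_fermat_tree N B A) \<subseteq> simplex_of N A"
    by (rule hull_minimal) (simp add: simplex_of_def)
  have "A ` {1..N + 1} \<subseteq> weighted_fermat_tree N B A"
    unfolding weighted_fermat_tree_def by blast
  then show "simplex_of N A \<subseteq> convex hull (weighted_fermat_tree N B A)"
    unfolding simplex_of_def by (rule hull_mono)
qed

lemma vertex_minimizes_iff_cosine_sum:
  fixes A :: "nat \<Rightarrow> real ^ 'n"
  assumes weights: "\<And>i. i \<in> {1..N + 1} \<Longrightarrow> B i > 0"
    and nd: "nondegenerate_simplex N A" and k: "k \<in> {1..N + 1}"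
  shows "minimizes_weighted_distance N B A (A k) \<longleftrightarrow>
    weighted_cosine_sum N B A k \<le> ((B k)\<^sup>2 - (\<Sum>i\<in>{1..N + 1} - {k}. (B i)\<^sup>2)) / 2"
proof -
  let ?V = "\<Sum>i\<in>{1..N + 1} - {k}. B i *\<^sub>R sgn (A i - A k)"
  have inj: "inj_on A {1..N + 1}" using nd by (simp add: nondegenerate_simplex_def)
  have "minimizes_weighted_distance N B A (A k) \<longleftrightarrow> norm ?V \<le> B k"
    unfolding minimizes_weighted_distance_def weighted_distance_sum_def
    by (rule vertex_minimizer_iff) (use inj k weights in auto)
  also have "\<dots> \<longleftrightarrow> (norm ?V)\<^sup>2 \<le> (B k)\<^sup>2"
    using weights[OF k] by (simp add: abs_le_square_iff[symmetric])
  finally show ?thesis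
    unfolding norm_weighted_directions[OF inj k] by (simp add: field_simps)
qed

theorem theorem1:
  fixes N :: nat
    and B :: "nat \<Rightarrow> real"
    and t :: "real list"
    and l s :: real
    and R :: "(nat \<Rightarrow> real ^ 'n) set"
  assumes dim: "CARD('n) = N" and N: "N \<ge> 2"
    and weights: "\<And>i. i \<in> {1..N + 1} \<Longrightarrow> B i > 0"
    and length: "length t = N * (N + 1) div 2"
    and pos: "\<And>x. x \<in> set t \<Longrightarrow> x > 0"
    and range: "\<And>x. x \<in> set t \<Longrightarrow> s \<le> x \<and> x \<le> l"
    and DW: "(l, s) \<in> DW_domain N"
    and reps: "simplex_representatives N t R"
  shows "finite (weighted_fermat_frechet_solution N B R) \<and>
    real (card (weighted_fermat_frechet_solution N B R))
      \<le> fact (N * (N + 1) div 2) / fact (N + 1) \<and>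
    bij_betw (weighted_fermat_tree N B) R (weighted_fermat_frechet_solution N B R) \<and>
    (\<forall>A\<in>R.
      (\<exists>!X. minimizes_weighted_distance N B A X) \<and>
      ((\<forall>k\<in>{1..N + 1}.
          weighted_cosine_sum N B A k > ((B k)\<^sup>2 - (\<Sum>i\<in>{1..N + 1} - {k}. (B i)\<^sup>2)) / 2)
        \<longrightarrow> floating N B A \<and>
            weighted_fermat_tree N B A =
              (\<Union>i\<in>{1..N + 1}. closed_segment (weighted_fermat_point N B A) (A i))) \<and>
      (\<forall>k\<in>{1..N + 1}.
          weighted_cosine_sum N B A k \<le> ((B k)\<^sup>2 - (\<Sum>i\<in>{1..N + 1} - {k}. (B i)\<^sup>2)) / 2
        \<longrightarrow> absorbing N B A \<and>
            weighted_fermat_point N B A = A k \<and>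
            weighted_fermat_tree N B A =
              (\<Union>i\<in>{1..N + 1} - {k}. closed_segment (A k) (A i))))"
proof (intro conjI ballI impI)
  let ?W = "weighted_fermat_frechet_solution N B R"
  have nd: "nondegenerate_simplex N A" if "A \<in> R" for A
    using reps that unfolding simplex_representatives_def determined_by_def by blast
  have ex1: "\<exists>!X. minimizes_weighted_distance N B A X" if "A \<in> R" for A
    by (rule weighted_fermat_point_unique[OF N]) (use weights nd[OF that] in auto)
  have vertex: "minimizes_weighted_distance N B A (A k) \<longleftrightarrow>
      weighted_cosine_sum N B A k \<le> ((B k)\<^sup>2 - (\<Sum>i\<in>{1..N + 1} - {k}. (B i)\<^sup>2)) / 2"
    if "A \<in> R" "k \<in> {1..N + 1}" for A k
    by (rule vertex_minimizes_iff_cosine_sum) (use weights nd[OF that(1)] that(2) in auto)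
  have hull: "convex hull (weighted_fermat_tree N B A) = simplex_of N A" if "A \<in> R" for A
    by (rule convex_hull_weighted_fermat_tree) (use weights ex1[OF that] in auto)
  note R = card_representatives[OF dim N reps]
  have "inj_on (weighted_fermat_tree N B) R"
  proof (rule inj_onI)
    fix A A' assume A: "A \<in> R" and A': "A' \<in> R"
      and eq: "weighted_fermat_tree N B A = weighted_fermat_tree N B A'"
    have "simplex_of N A = simplex_of N A'"
      using hull[OF A] hull[OF A'] eq by simp
    then show "A = A'"
      using representatives_unique[OF reps A A'] congruent_sets_refl by metis
  qed
  then show bij: "bij_betw (weighted_fermat_tree N B) R ?W"
    unfolding weighted_fermat_frechet_solution_def by (rule inj_on_imp_bij_betw)
  show "finite ?W" using R(1) by (simp add: weighted_fermat_frechet_solution_def)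
  have "real (card R * fact (N + 1)) \<le> real (fact (length t))"
    using R(2) by (simp only: of_nat_le_iff)
  then show "real (card ?W) \<le> fact (N * (N + 1) div 2) / fact (N + 1)"
    unfolding bij_betw_same_card[OF bij, symmetric] length
    by (simp add: pos_le_divide_eq del: fact_Suc)
  fix A assume A: "A \<in> R"
  show ex: "\<exists>!X. minimizes_weighted_distance N B A X" using ex1[OF A] .
  show "weighted_fermat_tree N B A =
      (\<Union>i\<in>{1..N + 1}. closed_segment (weighted_fermat_point N B A) (A i))"
    by (rule weighted_fermat_tree_def)
  show "floating N B A"
    if "\<forall>k\<in>{1..N + 1}.
      weighted_cosine_sum N B A k > ((B k)\<^sup>2 - (\<Sum>i\<in>{1..N + 1} - {k}. (B i)\<^sup>2)) / 2"
    unfolding floating_def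
  proof
    assume "weighted_fermat_point N B A \<in> A ` {1..N + 1}"
    then obtain k where k: "k \<in> {1..N + 1}" "weighted_fermat_point N B A = A k" by blast
    then have "minimizes_weighted_distance N B A (A k)"
      using weighted_fermat_point_minimizes[OF ex] by simp
    then show False using vertex[OF A k(1)] that k(1) by force
  qed
  fix k assume k: "k \<in> {1..N + 1}"
    and le: "weighted_cosine_sum N B A k \<le> ((B k)\<^sup>2 - (\<Sum>i\<in>{1..N + 1} - {k}. (B i)\<^sup>2)) / 2"
  have "minimizes_weighted_distance N B A (A k)" using vertex[OF A k] le by simp
  then show point: "weighted_fermat_point N B A = A k"
    using ex weighted_fermat_point_minimizes[OF ex] by blast
  then show "absorbing N B A" using k by (simp add: absorbing_def)
  obtain j where j: "j \<in> {1..N + 1} - {k}"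
    using N that[of "if k = 1 then 2 else 1"] by (auto split: if_splits)
  have "closed_segment (A k) (A k) \<subseteq> closed_segment (A k) (A j)" by simp
  moreover have "{1..N + 1} = insert k ({1..N + 1} - {k})" using k by blast
  ultimately show "weighted_fermat_tree N B A = (\<Union>i\<in>{1..N + 1} - {k}. closed_segment (A k) (A i))"
    unfolding weighted_fermat_tree_def point using j by blast
qed

end
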